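(* Assume that the covariance matrix $C_k$ is non-singular for every $k\in\mathcal{K}$. Then the optimization problem $$\text{(A)}\qquad \min_{\bm{n}\ge\bm{0}}\ \bm{n}^T\bm{c}\quad\text{s.t.}\quad \bm{e}_1^T\Psi^\dagger(\bm{n})\bm{e}_1\le\varepsilon^2,\quad \bm{n}^T\bm{h}\ge 1,$$ and the semidefinite program $$\text{(B)}\qquad \min_{\bm{n}\ge\bm{0}}\ \bm{n}^T\bm{c}\quad\text{s.t.}\quad \Phi(\varepsilon^2,\bm{n})=\begin{bmatrix}\Psi(\bm{n}) & \bm{e}_1\\ \bm{e}_1^T & \varepsilon^2\end{bmatrix}\succeq 0,\quad \bm{n}^T\bm{h}\ge 1,$$ are equivalent. That is, the two problems have the same feasible vectors $\bm{n}$, and hence the same optimal value and the same optimal solutions.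
   Context: Let $\mathcal{M}=\{\mathcal{M}_1,\dots,\mathcal{M}_\ell\}$ be a set of $\ell$ models, $\mathcal{M}_1$ being the high-fidelity model; model $\mathcal{M}_i$ has as output a real random variable $p_i(\omega)$ of finite variance (all defined on a common probability space). Let $\mathcal{G}=\{\mathcal{G}_k\}_{k\in\mathcal{K}}\subseteq 2^{\mathcal{M}}\setminus\{\emptyset\}$, with $\mathcal{K}=\{1,\dots,|\mathcal{G}|\}$, be a given set of distinct nonempty model groups. For each $k\in\mathcal{K}$, let $\bm{p}^k=[p_i]_{\mathcal{M}_i\in\mathcal{G}_k}$ be the random vector of the outputs of the models in $\mathcal{G}_k$ (in increasing order of $i$), let $C_k=C(\bm{p}^k,\bm{p}^k)$ be its covariance matrix, and let $R_k\in\mathbb{R}^{|\mathcal{G}_k|\times\ell}$ be the boolean restriction matrix made of the rows of the $\ell\times\ell$ identity matrix with indices $i$ such that $\mathcal{M}_i\in\mathcal{G}_k$ (in the same order). For $\bm{n}=[n_k]_{k\in\mathcal{K}}\ge\bm{0}$ (entrywise), define $$\Psi(\bm{n})=\sum_{k\in\mathcal{K}} n_k\,R_k^T C_k^{-1}R_k\in\mathbb{R}^{\ell\times\ell},$$ and let $\Psi^\dagger(\bm{n})$ be its Moore-Penrose pseudo-inverse. Here $\bm{e}_1=[1,0,\dots,0]^T\in\mathbb{R}^\ell$; $\bm{c}\in\mathbb{R}^{|\mathcal{G}|}$ is the cost vector, $c_k$ being the cost of one sample of group $\mathcal{G}_k$; $\varepsilon^2>0$ is a prescribed statistical error tolerance;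 and $\bm{h}\in\{0,1\}^{|\mathcal{G}|}$ is defined by $h_k=1$ if and only if $\mathcal{M}_1\in\mathcal{G}_k$. $A\succeq 0$ means that the symmetric matrix $A$ is positive semi-definite. The variable $\bm{n}$ ranges over nonnegative real vectors in $\mathbb{R}^{|\mathcal{G}|}$ (continuous relaxation of integer sample numbers), in both problems. *)

theory Defs
  imports
    "HOL-Probability.Probability_Measure"
    "Jordan_Normal_Form.Gauss_Jordan_Elimination"
    "Jordan_Normal_Form.DL_Submatrix"
begin

unbundle no vec_syntax
unbundle no inner_syntax
hide_type (open) Finite_Cartesian_Product.vec
hide_const (open) Finite_Cartesian_Product.vec Finite_Cartesian_Product.mat

text \<open>
  Indices are 0-based: there are \<open>l\<close> models, \<open>{..<l}\<close>, the high-fidelity model being \<open>0\<close>, and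
  \<open>p i\<close> is the output of model \<open>i\<close>.  A group is a set of model indices, and the set of groups is
  enumerated by a list \<open>Gs\<close> without repetitions.  The vector \<open>e\<^sub>1\<close> is thus \<open>unit_vec l 0\<close>.
\<close>

definition finite_variance :: "'a measure \<Rightarrow> ('a \<Rightarrow> real) \<Rightarrow> bool" where
  "finite_variance M X \<longleftrightarrow>
     X \<in> borel_measurable M \<and> integrable M X \<and>
     integrable M (\<lambda>\<omega>. (X \<omega> - integral\<^sup>L M X)\<^sup>2)"

definition covariance :: "'a measure \<Rightarrow> ('a \<Rightarrow> real) \<Rightarrow> ('a \<Rightarrow> real) \<Rightarrow> real" where
  "covariance M X Y =
     integral\<^sup>L M (\<lambda>\<omega>. (X \<omega> - integral\<^sup>L M X) * (Y \<omega> - integral\<^sup>L M Y))"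

definition cov_mat ::
  "'a measure \<Rightarrow> ('a \<Rightarrow> real) vec \<Rightarrow> ('a \<Rightarrow> real) vec \<Rightarrow> real mat" where
  "cov_mat M X Y = mat (dim_vec X) (dim_vec Y) (\<lambda>(i, j). covariance M (X $ i) (Y $ j))"

text \<open>\<open>pick G i\<close> is the \<open>i\<close>-th smallest element of \<open>G\<close>; \<open>submatrix\<close> orders rows in the same way.\<close>

definition group_output :: "(nat \<Rightarrow> 'a \<Rightarrow> real) \<Rightarrow> nat set \<Rightarrow> ('a \<Rightarrow> real) vec" where
  "group_output p G = vec (card G) (\<lambda>i. p (pick G i))"

definition group_cov :: "'a measure \<Rightarrow> (nat \<Rightarrow> 'a \<Rightarrow> real) \<Rightarrow> nat set \<Rightarrow> real mat" where
  "group_cov M p G = cov_mat M (group_output p G) (group_output p G)"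

definition restriction_mat :: "nat \<Rightarrow> nat set \<Rightarrow> real mat" where
  "restriction_mat l G = submatrix (1\<^sub>m l) G UNIV"

text \<open>
  The sum of matrices is written out entrywise.  \<open>mat_inverse\<close> returns \<open>None\<close> exactly on singular
  matrices, so the value of \<open>the\<close> is meaningful only for non-singular group covariances.
\<close>

definition Psi ::
  "'a measure \<Rightarrow> (nat \<Rightarrow> 'a \<Rightarrow> real) \<Rightarrow> nat \<Rightarrow> nat set list \<Rightarrow> real vec \<Rightarrow> real mat" where
  "Psi M p l Gs n = mat l l (\<lambda>(i, j). \<Sum>k<length Gs.
     (n $ k \<cdot>\<^sub>m (transpose_mat (restriction_mat l (Gs ! k))
                 * the (mat_inverse (group_cov M p (Gs ! k)))
                 * restriction_mat l (Gs ! k))) $$ (i, j))"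

text \<open>The four Penrose conditions; over the reals the adjoint is the transpose.\<close>

definition is_pseudo_inverse :: "real mat \<Rightarrow> real mat \<Rightarrow> bool" where
  "is_pseudo_inverse A X \<longleftrightarrow>
     X \<in> carrier_mat (dim_col A) (dim_row A) \<and>
     A * X * A = A \<and> X * A * X = X \<and>
     transpose_mat (A * X) = A * X \<and> transpose_mat (X * A) = X * A"

definition pseudo_inverse :: "real mat \<Rightarrow> real mat" where
  "pseudo_inverse A = (THE X. is_pseudo_inverse A X)"

definition pos_semidef :: "real mat \<Rightarrow> bool" where
  "pos_semidef A \<longleftrightarrow>
     square_mat A \<and> transpose_mat A = A \<and>
     (\<forall>v \<in> carrier_vec (dim_row A). 0 \<le> v \<bullet> (A *\<^sub>v v))"

definition Phi ::
  "'a measure \<Rightarrow> (nat \<Rightarrow> 'a \<Rightarrow> real) \<Rightarrow> nat \<Rightarrow> nat set list \<Rightarrow> real \<Rightarrow> real vec \<Rightarrow> real mat" where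
  "Phi M p l Gs t n = four_block_mat
     (Psi M p l Gs n)                  (mat_of_cols l [unit_vec l 0])
     (mat_of_rows l [unit_vec l 0])    (mat 1 1 (\<lambda>_. t))"

definition hf_indicator :: "nat set list \<Rightarrow> real vec" where
  "hf_indicator Gs = vec (length Gs) (\<lambda>k. if 0 \<in> Gs ! k then 1 else 0)"

text \<open>The order on vectors is entrywise; \<open>v \<le> w\<close> includes equality of the dimensions.\<close>

definition feasible_pinv ::
  "'a measure \<Rightarrow> (nat \<Rightarrow> 'a \<Rightarrow> real) \<Rightarrow> nat \<Rightarrow> nat set list \<Rightarrow> real \<Rightarrow> real vec set" where
  "feasible_pinv M p l Gs eps = {n \<in> carrier_vec (length Gs).
     0\<^sub>v (length Gs) \<le> n \<and>
     unit_vec l 0 \<bullet> (pseudo_inverse (Psi M p l Gs n) *\<^sub>v unit_vec l 0) \<le> eps\<^sup>2 \<and>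
     n \<bullet> hf_indicator Gs \<ge> 1}"

definition feasible_sdp ::
  "'a measure \<Rightarrow> (nat \<Rightarrow> 'a \<Rightarrow> real) \<Rightarrow> nat \<Rightarrow> nat set list \<Rightarrow> real \<Rightarrow> real vec set" where
  "feasible_sdp M p l Gs eps = {n \<in> carrier_vec (length Gs).
     0\<^sub>v (length Gs) \<le> n \<and>
     pos_semidef (Phi M p l Gs (eps\<^sup>2) n) \<and>
     n \<bullet> hf_indicator Gs \<ge> 1}"

text \<open>The optimal value is \<open>\<infinity>\<close> for an infeasible problem and \<open>-\<infinity>\<close> for an unbounded one.\<close>

definition optimal_value :: "('b \<Rightarrow> real) \<Rightarrow> 'b set \<Rightarrow> ereal" where
  "optimal_value f F = (INF x\<in>F. ereal (f x))"

definition optimal_solutions :: "('b \<Rightarrow> real) \<Rightarrow> 'b set \<Rightarrow> 'b set" where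
  "optimal_solutions f F = {x. is_arg_min f (\<lambda>y. y \<in> F) x}"

end

theory Submission
  imports Defs
begin

text \<open>
  The cost function and the constraints on the sign of \<open>n\<close> and on \<open>n \<bullet> h\<close> are common to both
  problems, so everything reduces to comparing the constraint \<open>e\<^sub>1 \<bullet> \<Psi>\<^sup>\<dagger> e\<^sub>1 \<le> \<epsilon>\<^sup>2\<close>
  with positive semidefiniteness of the bordered matrix, for a fixed allocation
  \<open>n \<ge> 0\<close> with \<open>n \<bullet> h \<ge> 1\<close>.  This is a Schur complement criterion for a possibly singular block: if
  \<open>A\<close> is positive semidefinite and \<open>b\<close> is orthogonal to the kernel of \<open>A\<close>, then \<open>y = A\<^sup>\<dagger> b\<close> solves
  \<open>A y = b\<close>, and completing the square gives
  \<open>v \<bullet> A v + 2 s (v \<bullet> b) + t s\<^sup>2 = (v + s y) \<bullet> A (v + s y) + s\<^sup>2 (t - b \<bullet> y)\<close>,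
  which is nonnegative for all \<open>(v, s)\<close> exactly when \<open>b \<bullet> A\<^sup>\<dagger> b \<le> t\<close> (\<open>pos_semidef_bordered_iff\<close>).

  The criterion applies to \<open>A = \<Psi>(n)\<close> and \<open>b = e\<^sub>1\<close> because the quadratic form of \<open>\<Psi>(n)\<close> is
  \<open>\<Sum>k. n\<^sub>k (R\<^sub>k x) \<bullet> C\<^sub>k\<^sup>-\<^sup>1 (R\<^sub>k x)\<close>.  A nonsingular covariance matrix is positive definite, hence so is its
  inverse; thus the form is nonnegative, and \<open>\<Psi>(n) x = 0\<close> forces \<open>R\<^sub>k x = 0\<close> for each \<open>k\<close> with \<open>n\<^sub>k > 0\<close>
  (\<open>Psi_pos_semidef_and_kernel\<close>).  The constraint \<open>n \<bullet> h \<ge> 1\<close> provides such a \<open>k\<close> whose group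
  contains the high-fidelity model, so the high-fidelity entry of every kernel vector is \<open>0\<close>, which says that
  \<open>e\<^sub>1\<close> is orthogonal to the kernel.

  The pseudo-inverse is given by a definite description, which has a meaning only through existence and
  uniqueness.  Existence is derived for every real matrix from inner inverses, that is, solutions
  \<open>G\<close> of \<open>A G A = A\<close>, without spectral theory (\<open>inner_inverse_exists\<close>, \<open>pseudo_inverse_exists\<close>).
\<close>

section \<open>Matrix algebra\<close>

lemma mult_assoc_mat_dim:
  fixes A :: "'b :: semiring_0 mat"
  assumes "dim_col A = dim_row B" "dim_col B = dim_row C"
  shows "(A * B) * C = A * (B * C)"
  using assms by (intro assoc_mult_mat[of _ "dim_row A" "dim_row B" _ "dim_row C" _ "dim_col C"]) auto

lemma mult_mat_entry:
  assumes "A \<in> carrier_mat m n" "B \<in> carrier_mat n k" "a < m" "b < k"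
  shows "(A * B) $$ (a, b) = (\<Sum>i<n. A $$ (a, i) * B $$ (i, b))"
  using assms by (simp add: scalar_prod_def lessThan_atLeast0)

lemma transpose_mult_dim:
  fixes A :: "'b :: comm_semiring_0 mat"
  assumes "dim_col A = dim_row B"
  shows "transpose_mat (A * B) = transpose_mat B * transpose_mat A"
  using assms by (intro transpose_mult[of _ "dim_row A" "dim_row B" _ "dim_col B"]) auto

lemma scalar_prod_self_nonneg:
  fixes v :: "real vec"
  shows "0 \<le> v \<bullet> v"
  by (simp add: scalar_prod_def sum_nonneg)

lemma scalar_prod_self_eq_0_imp_zero:
  fixes v :: "real vec"
  assumes "v \<in> carrier_vec n" "v \<bullet> v = 0"
  shows "v = 0\<^sub>v n"
proof (rule eq_vecI)
  fix i assume "i < dim_vec (0\<^sub>v n :: real vec)"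
  then show "v $ i = 0\<^sub>v n $ i"
    using assms by (auto simp: scalar_prod_def sum_nonneg_eq_0_iff)
qed (use assms in auto)

lemma gram_eq_0_imp_zero:
  fixes B :: "real mat"
  assumes B: "B \<in> carrier_mat m n" and 0: "transpose_mat B * B = 0\<^sub>m n n"
  shows "B = 0\<^sub>m m n"
proof (rule eq_matI)
  fix i j assume "i < dim_row (0\<^sub>m m n :: real mat)" "j < dim_col (0\<^sub>m m n :: real mat)"
  then have ij: "i < m" "j < n" by auto
  have "col B j \<bullet> col B j = (transpose_mat B * B) $$ (j, j)"
    using B ij by simp
  then have "col B j \<bullet> col B j = 0" using 0 ij by simp
  then have "col B j = 0\<^sub>v m"
    using B ij by (intro scalar_prod_self_eq_0_imp_zero) auto
  then have "col B j $ i = 0" using ij by simp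
  then show "B $$ (i, j) = 0\<^sub>m m n $$ (i, j)" using B ij by simp
qed (use B in auto)

section \<open>Existence and uniqueness of the pseudo-inverse\<close>

text \<open>
  Gaussian elimination without row reduction: if \<open>E\<close> carries the reciprocal of a pivot \<open>A $$ (i, j) \<noteq> 0\<close>
  at position \<open>(j, i)\<close>, then \<open>A - A * E * A\<close> has a zero row \<open>i\<close> and keeps the zero rows of \<open>A\<close>, and an
  inner inverse of it lifts back to one of \<open>A\<close>.
\<close>

lemma inner_inverse_exists:
  fixes A :: "'b :: field mat"
  assumes "A \<in> carrier_mat m n"
  shows "\<exists>G \<in> carrier_mat n m. A * G * A = A"
  using assms
proof (induction "card {i. i < m \<and> (\<exists>j<n. A $$ (i, j) \<noteq> 0)}" arbitrary: A rule: less_induct)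
  case less
  note A = less.prems
  show ?case
  proof (cases "\<exists>i<m. \<exists>j<n. A $$ (i, j) \<noteq> 0")
    case False
    then have "A = 0\<^sub>m m n" using A by (intro eq_matI) auto
    then show ?thesis by (intro bexI[of _ "0\<^sub>m n m"]) auto
  next
    case True
    then obtain i j where ij: "i < m" "j < n" "A $$ (i, j) \<noteq> 0" by blast
    define E where "E = mat n m (\<lambda>(a, b). if a = j \<and> b = i then inverse (A $$ (i, j)) else 0)"
    define A' where "A' = A - A * E * A"
    have E: "E \<in> carrier_mat n m" by (simp add: E_def)
    have A': "A' \<in> carrier_mat m n" using A E by (intro carrier_matI) (auto simp: A'_def)
    have AE: "(A * E) $$ (a, b) = (if b = i then A $$ (a, j) * inverse (A $$ (i, j)) else 0)"
      if "a < m" "b < m" for a b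
    proof -
      have "(A * E) $$ (a, b) = (\<Sum>k<n. A $$ (a, k) * E $$ (k, b))"
        using A E that by (rule mult_mat_entry)
      also have "\<dots> = (\<Sum>k<n. if k = j then if b = i then A $$ (a, j) * inverse (A $$ (i, j)) else 0 else 0)"
        by (rule sum.cong) (use that in \<open>auto simp: E_def\<close>)
      finally show ?thesis using ij by simp
    qed
    have AEA: "(A * E * A) $$ (a, b) = A $$ (a, j) * inverse (A $$ (i, j)) * A $$ (i, b)"
      if "a < m" "b < n" for a b
    proof -
      have "(A * E * A) $$ (a, b) = (\<Sum>k<m. (A * E) $$ (a, k) * A $$ (k, b))"
        using A E that by (intro mult_mat_entry[of _ m m _ n]) auto
      also have "\<dots> = (\<Sum>k<m. if k = i then A $$ (a, j) * inverse (A $$ (i, j)) * A $$ (i, b) else 0)"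
        by (rule sum.cong) (use that AE in auto)
      finally show ?thesis using ij by simp
    qed
    have A'_eq: "A' $$ (a, b) = A $$ (a, b) - A $$ (a, j) * inverse (A $$ (i, j)) * A $$ (i, b)"
      if "a < m" "b < n" for a b
      using that A E AEA[OF that] by (simp add: A'_def del: index_mult_mat(1))
    have "card {a. a < m \<and> (\<exists>b<n. A' $$ (a, b) \<noteq> 0)} < card {a. a < m \<and> (\<exists>b<n. A $$ (a, b) \<noteq> 0)}"
    proof (rule psubset_card_mono)
      have "i \<in> {a. a < m \<and> (\<exists>b<n. A $$ (a, b) \<noteq> 0)}" using ij by auto
      moreover have "i \<notin> {a. a < m \<and> (\<exists>b<n. A' $$ (a, b) \<noteq> 0)}" using ij by (auto simp: A'_eq)
      moreover have "{a. a < m \<and> (\<exists>b<n. A' $$ (a, b) \<noteq> 0)} \<subseteq> {a. a < m \<and> (\<exists>b<n. A $$ (a, b) \<noteq> 0)}"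
        using ij by (auto simp: A'_eq) (metis mult_zero_left)
      ultimately show "{a. a < m \<and> (\<exists>b<n. A' $$ (a, b) \<noteq> 0)} \<subset> {a. a < m \<and> (\<exists>b<n. A $$ (a, b) \<noteq> 0)}"
        by blast
    qed simp
    from less.hyps[OF this A'] obtain G' where G': "G' \<in> carrier_mat n m" "A' * G' * A' = A'" by blast
    \<comment> \<open>Since \<open>A * P = A' = Q * A\<close>, the matrix \<open>E + P * G' * Q\<close> is an inner inverse: between two copies
       of \<open>A\<close> it gives \<open>A * E * A + A' * G' * A' = A * E * A + A' = A\<close>.\<close>
    define P where "P = 1\<^sub>m n - E * A"
    define Q where "Q = 1\<^sub>m m - A * E"
    have P: "P \<in> carrier_mat n n" and Q: "Q \<in> carrier_mat m m" using A E by (auto simp: P_def Q_def)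
    have AP: "A * P = A'" unfolding P_def A'_def
      using A E by (subst mult_minus_distrib_mat[of _ m n _ n]) (auto simp: mult_assoc_mat_dim)
    have QA: "Q * A = A'" unfolding Q_def A'_def
      using A E by (subst minus_mult_distrib_mat[of _ m m _ _ n]) auto
    have "A * (E + P * G' * Q) * A = A * E * A + (A * P) * G' * (Q * A)"
    proof -
      have "A * (E + P * G' * Q) = A * E + A * (P * G' * Q)"
        using A E P Q G' by (intro mult_add_distrib_mat) auto
      moreover have "(A * E + A * (P * G' * Q)) * A = A * E * A + A * (P * G' * Q) * A"
        using A E P Q G' by (intro add_mult_distrib_mat) auto
      moreover have "A * (P * G' * Q) * A = (A * P) * G' * (Q * A)"
        using A E P Q G' by (simp add: mult_assoc_mat_dim)
      ultimately show ?thesis by simp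
    qed
    also have "\<dots> = A * E * A + A'" using G' by (simp add: AP QA)
    also have "\<dots> = A" using A E unfolding A'_def by (intro eq_matI) auto
    finally show ?thesis using P Q G' E by (intro bexI[of _ "E + P * G' * Q"]) auto
  qed
qed

text \<open>
  With an inner inverse \<open>G\<close> of the Gram matrix, \<open>A * G * A\<^sup>T\<close> is the orthogonal projection onto the
  column space of \<open>A\<close>, written without inverting anything.
\<close>

lemma column_space_projection:
  fixes A :: "real mat"
  assumes A: "A \<in> carrier_mat m n"
  obtains G where "G \<in> carrier_mat n n"
    "A * G * transpose_mat A * A = A"
    "transpose_mat (A * G * transpose_mat A) = A * G * transpose_mat A"
proof -
  let ?T = "transpose_mat A"
  have T: "?T \<in> carrier_mat n m" using A by simp
  obtain G where G: "G \<in> carrier_mat n n" and GG: "?T * A * G * (?T * A) = ?T * A"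
    using inner_inverse_exists[of "?T * A" n n] A by auto
  note dims = carrier_matD[OF A] carrier_matD[OF T] carrier_matD[OF G]
  define P where "P = A * G * ?T"
  have P: "P \<in> carrier_mat m m" using A G by (simp add: P_def)
  define B where "B = P * A - A"
  have B: "B \<in> carrier_mat m n" using A P by (intro carrier_matI) (auto simp: B_def)
  \<comment> \<open>Left cancellation of \<open>A\<^sup>T\<close>: the columns of \<open>B\<close> lie in the column space of \<open>A\<close> and are
     orthogonal to it.\<close>
  have TB: "?T * B = 0\<^sub>m n n"
  proof -
    have "?T * B = ?T * (P * A) - ?T * A" unfolding B_def
      using A P T by (intro mult_minus_distrib_mat) auto
    also have "?T * (P * A) = ?T * A" using GG by (simp add: P_def mult_assoc_mat_dim dims)
    finally show ?thesis using A by simp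
  qed
  have "transpose_mat B * B = 0\<^sub>m n n"
  proof -
    have "transpose_mat B = ?T * transpose_mat P - ?T" unfolding B_def
      using A P by (simp add: transpose_minus[of _ m n] transpose_mult[of _ m m _ n])
    then have "transpose_mat B * B = ?T * transpose_mat P * B - ?T * B"
      using A P B by (simp add: minus_mult_distrib_mat[of _ n m _ _ n])
    also have "?T * transpose_mat P * B = ?T * A * transpose_mat G * (?T * B)"
      using dims B by (simp add: P_def transpose_mult_dim mult_assoc_mat_dim)
    finally show ?thesis using A G by (simp add: TB)
  qed
  then have B0: "B = 0\<^sub>m m n" using B by (rule gram_eq_0_imp_zero[rotated])
  have PA: "P * A = A"
  proof (rule eq_matI)
    fix i j assume ij: "i < dim_row A" "j < dim_col A"
    then have "B $$ (i, j) = (P * A) $$ (i, j) - A $$ (i, j)"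
      using A P unfolding B_def by (intro index_minus_mat) auto
    then show "(P * A) $$ (i, j) = A $$ (i, j)" using B0 ij A by simp
  qed (use A P in auto)
  have PP: "P * transpose_mat P = transpose_mat P"
  proof -
    have "P * transpose_mat P = P * A * transpose_mat G * ?T"
      using P dims by (simp add: P_def transpose_mult_dim mult_assoc_mat_dim)
    also have "\<dots> = transpose_mat P"
      unfolding PA using dims by (simp add: P_def transpose_mult_dim mult_assoc_mat_dim)
    finally show ?thesis .
  qed
  have "transpose_mat (P * transpose_mat P) = P * transpose_mat P"
    using P by (simp add: transpose_mult_dim)
  then have "transpose_mat P = P" unfolding PP by simp
  then show thesis using that[OF G] PA unfolding P_def by simp
qed

text \<open>
  The witness is \<open>X = A\<^sup>T * H * A * G * A\<^sup>T\<close>, where \<open>A * G * A\<^sup>T\<close> and \<open>A\<^sup>T * H * A\<close> are the orthogonal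
  projections onto the column space and the row space of \<open>A\<close>; these are the products \<open>A * X\<close> and
  \<open>X * A\<close>.
\<close>

lemma pseudo_inverse_exists: "\<exists>X. is_pseudo_inverse A X"
proof -
  let ?T = "transpose_mat A"
  obtain m n where A: "A \<in> carrier_mat m n" by blast
  have T: "?T \<in> carrier_mat n m" using A by simp
  obtain G where G: "G \<in> carrier_mat n n" "A * G * ?T * A = A" "transpose_mat (A * G * ?T) = A * G * ?T"
    using column_space_projection[OF A] by metis
  obtain H where H: "H \<in> carrier_mat m m" "?T * H * A * ?T = ?T" "transpose_mat (?T * H * A) = ?T * H * A"
    using column_space_projection[OF T] by (metis transpose_transpose)
  note dims = carrier_matD[OF A] carrier_matD[OF T] carrier_matD[OF G(1)] carrier_matD[OF H(1)]
  define P where "P = A * G * ?T"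
  define Q where "Q = ?T * H * A"
  define X where "X = ?T * H * P"
  have AQ: "A * Q = A"
  proof -
    have "transpose_mat (Q * ?T) = A" using H(2) by (simp add: Q_def)
    moreover have "transpose_mat (Q * ?T) = A * Q"
      using H(3) dims by (simp add: Q_def transpose_mult_dim[of "?T * H * A" ?T])
    ultimately show ?thesis by simp
  qed
  have PA: "P * A = A" using G(2) by (simp add: P_def)
  have AX: "A * X = P"
  proof -
    have "A * X = A * Q * G * ?T" using dims by (simp add: X_def P_def Q_def mult_assoc_mat_dim)
    then show ?thesis using AQ by (simp add: P_def)
  qed
  have XA: "X * A = Q"
  proof -
    have "X * A = ?T * H * (P * A)" using dims by (simp add: X_def P_def mult_assoc_mat_dim)
    then show ?thesis unfolding PA by (simp add: Q_def)
  qed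
  have "X * A * X = X"
  proof -
    have "Q * X = ?T * H * (A * X)" using dims by (simp add: X_def P_def Q_def mult_assoc_mat_dim)
    then show ?thesis unfolding XA AX by (simp add: X_def)
  qed
  moreover have "X \<in> carrier_mat (dim_col A) (dim_row A)" using dims by (auto simp: X_def P_def)
  ultimately have "is_pseudo_inverse A X"
    using G(3) H(3) PA unfolding is_pseudo_inverse_def AX XA P_def Q_def by simp
  then show ?thesis by blast
qed

lemma pseudo_inverse_unique:
  assumes X: "is_pseudo_inverse A X" and Y: "is_pseudo_inverse A Y"
  shows "X = Y"
proof -
  note X = X[unfolded is_pseudo_inverse_def] and Y = Y[unfolded is_pseudo_inverse_def]
  have dims: "dim_row X = dim_col A" "dim_col X = dim_row A" "dim_row Y = dim_col A" "dim_col Y = dim_row A"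
    using X Y by auto
  \<comment> \<open>Both products are the orthogonal projection onto the column space (row space) of \<open>A\<close>.\<close>
  have AX: "A * X = A * Y"
  proof -
    have "A * X = (A * Y) * (A * X)" using Y dims by (metis mult_assoc_mat_dim index_mult_mat(2,3))
    then have "transpose_mat (A * X) = transpose_mat (A * X) * transpose_mat (A * Y)"
      using dims by (metis transpose_mult_dim index_mult_mat(2,3))
    then have "A * X = (A * X) * (A * Y)" using X Y by simp
    also have "\<dots> = A * X * A * Y" using dims by (simp add: mult_assoc_mat_dim)
    finally show ?thesis using X by simp
  qed
  have XA: "X * A = Y * A"
  proof -
    have "X * A = (X * A) * (Y * A)" using Y dims by (metis mult_assoc_mat_dim index_mult_mat(2,3))
    then have "transpose_mat (X * A) = transpose_mat (Y * A) * transpose_mat (X * A)"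
      using dims by (metis transpose_mult_dim index_mult_mat(2,3))
    then have "X * A = (Y * A) * (X * A)" using X Y by simp
    also have "\<dots> = Y * (A * X * A)" using dims by (simp add: mult_assoc_mat_dim)
    finally show ?thesis using X by simp
  qed
  have "X = Y * A * X" using X XA by simp
  also have "\<dots> = Y * (A * X)" using dims by (simp add: mult_assoc_mat_dim)
  also have "\<dots> = Y * A * Y" unfolding AX using dims by (simp add: mult_assoc_mat_dim)
  finally show ?thesis using Y by simp
qed

lemma is_pseudo_inverse_pseudo_inverse: "is_pseudo_inverse A (pseudo_inverse A)"
  unfolding pseudo_inverse_def
  by (rule theI', rule ex_ex1I[OF pseudo_inverse_exists pseudo_inverse_unique])

section \<open>Positive semidefinite matrices\<close>

lemma symmetric_form_swap:
  fixes A :: "real mat"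
  assumes "A \<in> carrier_mat n n" "transpose_mat A = A" "x \<in> carrier_vec n" "y \<in> carrier_vec n"
  shows "x \<bullet> (A *\<^sub>v y) = y \<bullet> (A *\<^sub>v x)"
proof -
  have "x \<bullet> (A *\<^sub>v y) = (A *\<^sub>v x) \<bullet> y"
    using transpose_vec_mult_scalar[of A n n y x] assms by simp
  also have "\<dots> = y \<bullet> (A *\<^sub>v x)" using assms by (intro comm_scalar_prod[of _ n]) auto
  finally show ?thesis .
qed

lemma symmetric_form_expand:
  fixes A :: "real mat"
  assumes A: "A \<in> carrier_mat n n" "transpose_mat A = A" and xy: "x \<in> carrier_vec n" "y \<in> carrier_vec n"
  shows "(x + s \<cdot>\<^sub>v y) \<bullet> (A *\<^sub>v (x + s \<cdot>\<^sub>v y))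
    = x \<bullet> (A *\<^sub>v x) + 2 * s * (x \<bullet> (A *\<^sub>v y)) + s\<^sup>2 * (y \<bullet> (A *\<^sub>v y))"
proof -
  have "A *\<^sub>v (x + s \<cdot>\<^sub>v y) = A *\<^sub>v x + s \<cdot>\<^sub>v (A *\<^sub>v y)"
    using A xy by (simp add: mult_add_distrib_mat_vec mult_mat_vec)
  then have "(x + s \<cdot>\<^sub>v y) \<bullet> (A *\<^sub>v (x + s \<cdot>\<^sub>v y))
    = x \<bullet> (A *\<^sub>v x) + s * (x \<bullet> (A *\<^sub>v y)) + s * (y \<bullet> (A *\<^sub>v x)) + s * (s * (y \<bullet> (A *\<^sub>v y)))"
    using A xy by (simp add: add_scalar_prod_distrib[of _ n] scalar_prod_add_distrib[of _ n] algebra_simps)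
  then show ?thesis
    using symmetric_form_swap[OF A xy] by (simp add: power2_eq_square algebra_simps)
qed

text \<open>
  A nonnegative quadratic form has a minimum at any of its zeros \<open>x\<close>, so its gradient \<open>2 A x\<close> vanishes
  there.
\<close>

lemma pos_semidef_form_eq_0_imp_kernel:
  assumes psd: "pos_semidef A" and A: "A \<in> carrier_mat n n" and x: "x \<in> carrier_vec n"
    and 0: "x \<bullet> (A *\<^sub>v x) = 0"
  shows "A *\<^sub>v x = 0\<^sub>v n"
proof -
  define y where "y = A *\<^sub>v x"
  define q where "q = y \<bullet> (A *\<^sub>v y)"
  define b where "b = y \<bullet> y"
  have y: "y \<in> carrier_vec n" using A x by (simp add: y_def)
  have sym: "transpose_mat A = A" using psd by (simp add: pos_semidef_def)
  have xy: "x \<bullet> (A *\<^sub>v y) = b"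
    unfolding b_def by (subst symmetric_form_swap[OF A sym x y]) (simp add: y_def)
  have ge: "0 \<le> 2 * s * b + s\<^sup>2 * q" for s
  proof -
    have "0 \<le> (x + s \<cdot>\<^sub>v y) \<bullet> (A *\<^sub>v (x + s \<cdot>\<^sub>v y))"
      using psd A x y by (simp add: pos_semidef_def)
    then show ?thesis unfolding symmetric_form_expand[OF A sym x y] 0 xy q_def by simp
  qed
  have q: "0 \<le> q" using psd A y by (simp add: pos_semidef_def q_def)
  have b: "0 \<le> b" unfolding b_def by (rule scalar_prod_self_nonneg)
  \<comment> \<open>A step of length \<open>b / (q + 1)\<close> against the gradient would make the form negative if \<open>b > 0\<close>.\<close>
  define u where "u = b / (q + 1)"
  have bu: "b = u * (q + 1)" using q by (simp add: u_def)
  have "2 * (- u) * b + (- u)\<^sup>2 * q = - (u\<^sup>2 * (q + 2))"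
    unfolding bu by (simp add: algebra_simps power2_eq_square)
  then have "u\<^sup>2 * (q + 2) \<le> 0" using ge[of "- u"] by linarith
  then have "u = 0" using q by (simp add: mult_le_0_iff)
  then have "b = 0" using bu by simp
  then have "y = 0\<^sub>v n" using y unfolding b_def by (intro scalar_prod_self_eq_0_imp_zero) auto
  then show ?thesis by (simp add: y_def)
qed

text \<open>
  A positive semidefinite matrix is positive definite once it is invertible, and \<open>w = C u\<close> turns the
  form of \<open>C\<^sup>-\<^sup>1\<close> at \<open>w\<close> into the form of \<open>C\<close> at \<open>u\<close>.
\<close>

lemma pos_def_inverse:
  assumes psd: "pos_semidef C" and C: "C \<in> carrier_mat n n" and D: "D \<in> carrier_mat n n"
    and CD: "C * D = 1\<^sub>m n" and DC: "D * C = 1\<^sub>m n"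
  shows "pos_semidef D"
    and "w \<in> carrier_vec n \<Longrightarrow> w \<bullet> (D *\<^sub>v w) = 0 \<Longrightarrow> w = 0\<^sub>v n"
proof -
  have symC: "transpose_mat C = C" using psd by (simp add: pos_semidef_def)
  have "transpose_mat D * C = 1\<^sub>m n"
    using transpose_mult[OF C D] by (simp add: CD symC)
  then have "transpose_mat D * (C * D) = D"
    using C D assoc_mult_mat[of "transpose_mat D" n n C n D n] by simp
  then have symD: "transpose_mat D = D" using CD D by simp
  have form: "w \<bullet> (D *\<^sub>v w) = (D *\<^sub>v w) \<bullet> (C *\<^sub>v (D *\<^sub>v w))"
    and inv: "C *\<^sub>v (D *\<^sub>v w) = w" if w: "w \<in> carrier_vec n" for w
  proof -
    show *: "C *\<^sub>v (D *\<^sub>v w) = w"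
      using assoc_mult_mat_vec[OF C D w] w by (simp add: CD)
    show "w \<bullet> (D *\<^sub>v w) = (D *\<^sub>v w) \<bullet> (C *\<^sub>v (D *\<^sub>v w))"
      unfolding * using D w by (intro comm_scalar_prod[of _ n]) auto
  qed
  have "0 \<le> w \<bullet> (D *\<^sub>v w)" if w: "w \<in> carrier_vec n" for w
    unfolding form[OF w] using psd C D w by (simp add: pos_semidef_def)
  then show "pos_semidef D" using symD D by (simp add: pos_semidef_def)
  show "w = 0\<^sub>v n" if w: "w \<in> carrier_vec n" and 0: "w \<bullet> (D *\<^sub>v w) = 0"
    using pos_semidef_form_eq_0_imp_kernel[OF psd C, of "D *\<^sub>v w"] form[OF w] inv[OF w] w D 0 by simp
qed

text \<open>
  For symmetric \<open>A\<close>, the residual \<open>b - A A\<^sup>\<dagger> b\<close> lies in the kernel of \<open>A\<close>; hence it is orthogonal to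
  \<open>b\<close> by assumption and to the range of \<open>A\<close> by symmetry, and therefore to itself.
\<close>

lemma pseudo_inverse_solves:
  assumes A: "A \<in> carrier_mat n n" and sym: "transpose_mat A = A" and b: "b \<in> carrier_vec n"
    and ker: "\<And>x. x \<in> carrier_vec n \<Longrightarrow> A *\<^sub>v x = 0\<^sub>v n \<Longrightarrow> x \<bullet> b = 0"
  shows "A *\<^sub>v (pseudo_inverse A *\<^sub>v b) = b"
proof -
  define X where "X = pseudo_inverse A"
  have "is_pseudo_inverse A X" unfolding X_def by (rule is_pseudo_inverse_pseudo_inverse)
  then have X: "X \<in> carrier_mat n n" and AXA: "A * X * A = A" and AX: "transpose_mat (A * X) = A * X"
    using A by (auto simp: is_pseudo_inverse_def)
  define z where "z = A *\<^sub>v (X *\<^sub>v b)"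
  define r where "r = b - z"
  have z: "z \<in> carrier_vec n" and r: "r \<in> carrier_vec n" using A X b by (auto simp: z_def r_def)
  have AAX: "A * (A * X) = A"
  proof -
    have "A * (A * X) = transpose_mat (A * X * A)"
      using A X by (subst transpose_mult[of "A * X" n n _ n]) (auto simp: sym AX)
    then show ?thesis using AXA sym by simp
  qed
  have "A *\<^sub>v z = (A * (A * X)) *\<^sub>v b" using A X b by (simp add: z_def assoc_mult_mat_vec[of _ n n _ n])
  then have "A *\<^sub>v z = A *\<^sub>v b" by (simp add: AAX)
  then have "A *\<^sub>v r = 0\<^sub>v n"
    using A b z by (simp add: r_def mult_minus_distrib_mat_vec[of _ n n])
  then have rb: "r \<bullet> b = 0" and Ar: "A *\<^sub>v r = 0\<^sub>v n" using ker r by auto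
  have "r \<bullet> z = (X *\<^sub>v b) \<bullet> (A *\<^sub>v r)"
    unfolding z_def using A X b r sym by (intro symmetric_form_swap) auto
  then have "r \<bullet> z = 0" using Ar X b by simp
  moreover have "r \<bullet> r = r \<bullet> b - r \<bullet> z"
    using r b z by (subst (2) r_def) (simp add: scalar_prod_minus_distrib[of _ n])
  ultimately have "r = 0\<^sub>v n" using rb r by (intro scalar_prod_self_eq_0_imp_zero) auto
  show ?thesis
  proof (rule eq_vecI)
    fix i assume "i < dim_vec b"
    then have i: "i < n" using b by simp
    have "r $ i = b $ i - z $ i" using i b z by (simp add: r_def)
    then show "(A *\<^sub>v (pseudo_inverse A *\<^sub>v b)) $ i = b $ i"
      using \<open>r = 0\<^sub>v n\<close> i unfolding z_def X_def by simp
  qed (use A b in auto)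
qed

text \<open>
  With \<open>y = A\<^sup>\<dagger> b\<close> and \<open>A y = b\<close>, completing the square turns the form of the bordered matrix at
  \<open>(v, s)\<close> into the form of \<open>A\<close> at \<open>v + s y\<close> plus \<open>s\<^sup>2 (t - b \<bullet> y)\<close>; the choice \<open>v = -y\<close>, \<open>s = 1\<close> isolates
  the second term.
\<close>

lemma pos_semidef_bordered_iff:
  assumes psd: "pos_semidef A" and A: "A \<in> carrier_mat n n" and b: "b \<in> carrier_vec n"
    and ker: "\<And>x. x \<in> carrier_vec n \<Longrightarrow> A *\<^sub>v x = 0\<^sub>v n \<Longrightarrow> x \<bullet> b = 0"
  shows "pos_semidef (four_block_mat A (mat_of_cols n [b]) (mat_of_rows n [b]) (mat 1 1 (\<lambda>_. t)))
    \<longleftrightarrow> b \<bullet> (pseudo_inverse A *\<^sub>v b) \<le> t"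
proof -
  let ?M = "four_block_mat A (mat_of_cols n [b]) (mat_of_rows n [b]) (mat 1 1 (\<lambda>_. t))"
  have sym: "transpose_mat A = A" using psd by (simp add: pos_semidef_def)
  have nonneg: "0 \<le> v \<bullet> (A *\<^sub>v v)" if "v \<in> carrier_vec n" for v
    using psd A that by (simp add: pos_semidef_def)
  define y where "y = pseudo_inverse A *\<^sub>v b"
  have "is_pseudo_inverse A (pseudo_inverse A)" by (rule is_pseudo_inverse_pseudo_inverse)
  then have y: "y \<in> carrier_vec n" using A b by (auto simp: is_pseudo_inverse_def y_def)
  have Ay: "A *\<^sub>v y = b"
    unfolding y_def using A sym b ker by (rule pseudo_inverse_solves)
  have cols: "mat_of_cols n [b] \<in> carrier_mat n 1" and rows: "mat_of_rows n [b] \<in> carrier_mat 1 n"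
    by auto
  have M: "?M \<in> carrier_mat (n + 1) (n + 1)" using A by (intro four_block_carrier_mat) auto
  have form: "(v @\<^sub>v vec 1 (\<lambda>_. s)) \<bullet> (?M *\<^sub>v (v @\<^sub>v vec 1 (\<lambda>_. s)))
      = (v + s \<cdot>\<^sub>v y) \<bullet> (A *\<^sub>v (v + s \<cdot>\<^sub>v y)) + s\<^sup>2 * (t - b \<bullet> y)"
    if v: "v \<in> carrier_vec n" for v s
  proof -
    have 1: "mat_of_cols n [b] *\<^sub>v vec 1 (\<lambda>_. s) = s \<cdot>\<^sub>v b"
      using b by (intro eq_vecI) (auto simp: scalar_prod_def mat_of_cols_index)
    have 2: "mat_of_rows n [b] *\<^sub>v v + mat 1 1 (\<lambda>_. t) *\<^sub>v vec 1 (\<lambda>_. s) = vec 1 (\<lambda>_. b \<bullet> v + t * s)"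
      using b v by (intro eq_vecI) (auto simp: scalar_prod_def mat_of_rows_index)
    have "?M *\<^sub>v (v @\<^sub>v vec 1 (\<lambda>_. s)) = (A *\<^sub>v v + s \<cdot>\<^sub>v b) @\<^sub>v vec 1 (\<lambda>_. b \<bullet> v + t * s)"
      using four_block_mat_mult_vec[OF A cols rows _ v, of "mat 1 1 (\<lambda>_. t)" "vec 1 (\<lambda>_. s)"]
      unfolding 1 2 by simp
    then have "(v @\<^sub>v vec 1 (\<lambda>_. s)) \<bullet> (?M *\<^sub>v (v @\<^sub>v vec 1 (\<lambda>_. s)))
      = v \<bullet> (A *\<^sub>v v + s \<cdot>\<^sub>v b) + s * (b \<bullet> v + t * s)"
      using A v b by (simp add: scalar_prod_append[of _ n _ 1]) (simp add: scalar_prod_def)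
    also have "\<dots> = v \<bullet> (A *\<^sub>v v) + 2 * s * (v \<bullet> b) + t * s\<^sup>2"
      using A v b comm_scalar_prod[OF b v]
      by (simp add: scalar_prod_add_distrib[of _ n] power2_eq_square algebra_simps)
    also have "\<dots> = (v + s \<cdot>\<^sub>v y) \<bullet> (A *\<^sub>v (v + s \<cdot>\<^sub>v y)) + s\<^sup>2 * (t - b \<bullet> y)"
      unfolding symmetric_form_expand[OF A sym v y] Ay comm_scalar_prod[OF b y]
      by (simp add: algebra_simps)
    finally show ?thesis .
  qed
  have split: "\<exists>v s. v \<in> carrier_vec n \<and> w = v @\<^sub>v vec 1 (\<lambda>_. s)" if w: "w \<in> carrier_vec (n + 1)" for w :: "real vec"
  proof (intro exI conjI)
    show "w = vec_first w n @\<^sub>v vec 1 (\<lambda>_. w $ n)"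
      using w by (intro eq_vecI) (auto simp: vec_first_def less_Suc_eq)
  qed simp
  have symM: "transpose_mat ?M = ?M"
    using A cols rows
    by (subst transpose_four_block_mat[of _ n n _ 1 _ 1])
      (auto simp: sym transpose_mat_of_rows transpose_mat_of_cols intro!: arg_cong[of _ _ "four_block_mat _ _ _"])
  show ?thesis
  proof
    assume M_psd: "pos_semidef ?M"
    let ?w = "- y @\<^sub>v vec 1 (\<lambda>_. 1)"
    have "?w \<in> carrier_vec (n + 1)" using y by (intro append_carrier_vec) auto
    then have "0 \<le> ?w \<bullet> (?M *\<^sub>v ?w)" using M_psd M unfolding pos_semidef_def by (metis carrier_matD(1))
    also have "\<dots> = (- y + 1 \<cdot>\<^sub>v y) \<bullet> (A *\<^sub>v (- y + 1 \<cdot>\<^sub>v y)) + 1\<^sup>2 * (t - b \<bullet> y)"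
      using y by (intro form) simp
    also have "- y + 1 \<cdot>\<^sub>v y = 0\<^sub>v n" using y by (intro eq_vecI) auto
    finally show "b \<bullet> (pseudo_inverse A *\<^sub>v b) \<le> t" using A by (simp add: y_def)
  next
    assume "b \<bullet> (pseudo_inverse A *\<^sub>v b) \<le> t"
    then have t: "0 \<le> t - b \<bullet> y" by (simp add: y_def)
    have "0 \<le> w \<bullet> (?M *\<^sub>v w)" if w: "w \<in> carrier_vec (n + 1)" for w
    proof -
      obtain v s where v: "v \<in> carrier_vec n" "w = v @\<^sub>v vec 1 (\<lambda>_. s)" using split[OF w] by blast
      show ?thesis unfolding v(2) form[OF v(1)]
        using nonneg[of "v + s \<cdot>\<^sub>v y"] v y t by simp
    qed
    then show "pos_semidef ?M" using symM M unfolding pos_semidef_def by (metis carrier_matD square_mat.elims(3))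
  qed
qed

section \<open>Covariance matrices\<close>

lemma integrable_mult_of_square_integrable:
  fixes f g :: "'a \<Rightarrow> real"
  assumes "f \<in> borel_measurable M" "g \<in> borel_measurable M"
    and "integrable M (\<lambda>\<omega>. (f \<omega>)\<^sup>2)" "integrable M (\<lambda>\<omega>. (g \<omega>)\<^sup>2)"
  shows "integrable M (\<lambda>\<omega>. f \<omega> * g \<omega>)"
proof (rule Bochner_Integration.integrable_bound)
  show "integrable M (\<lambda>\<omega>. (f \<omega>)\<^sup>2 + (g \<omega>)\<^sup>2)" using assms by simp
  show "(\<lambda>\<omega>. f \<omega> * g \<omega>) \<in> borel_measurable M" using assms by simp
  have "\<bar>a * b\<bar> \<le> a\<^sup>2 + b\<^sup>2" for a b :: real
  proof -
    have "2 * \<bar>a * b\<bar> \<le> a\<^sup>2 + b\<^sup>2"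
      using sum_squares_bound[of "\<bar>a\<bar>" "\<bar>b\<bar>"] by (simp add: abs_mult mult.assoc)
    then show ?thesis by linarith
  qed
  then show "AE \<omega> in M. norm (f \<omega> * g \<omega>) \<le> norm ((f \<omega>)\<^sup>2 + (g \<omega>)\<^sup>2)"
    by (intro AE_I2) (simp add: sum_power2_ge_zero)
qed

text \<open>The form of a covariance matrix at \<open>v\<close> is the variance of the combination with weights \<open>v\<close>.\<close>

lemma pos_semidef_cov_mat:
  assumes "\<And>i. i < dim_vec X \<Longrightarrow> finite_variance M (X $ i)"
  shows "pos_semidef (cov_mat M X X)"
proof -
  define Y where "Y i \<omega> = (X $ i) \<omega> - integral\<^sup>L M (X $ i)" for i \<omega>
  let ?n = "dim_vec X"
  have int: "integrable M (\<lambda>\<omega>. Y i \<omega> * Y j \<omega>)" if "i < ?n" "j < ?n" for i j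
    using assms[OF that(1)] assms[OF that(2)]
    by (intro integrable_mult_of_square_integrable) (auto simp: finite_variance_def Y_def)
  have cov: "cov_mat M X X = mat ?n ?n (\<lambda>(i, j). integral\<^sup>L M (\<lambda>\<omega>. Y i \<omega> * Y j \<omega>))"
    by (simp add: cov_mat_def covariance_def Y_def)
  have "0 \<le> v \<bullet> (cov_mat M X X *\<^sub>v v)" if v: "v \<in> carrier_vec ?n" for v
  proof -
    have "v \<bullet> (cov_mat M X X *\<^sub>v v)
      = (\<Sum>i<?n. \<Sum>j<?n. integral\<^sup>L M (\<lambda>\<omega>. v $ i * v $ j * (Y i \<omega> * Y j \<omega>)))"
      using v by (simp add: cov scalar_prod_def lessThan_atLeast0 sum_distrib_left algebra_simps)
    also have "\<dots> = (\<Sum>i<?n. integral\<^sup>L M (\<lambda>\<omega>. \<Sum>j<?n. v $ i * v $ j * (Y i \<omega> * Y j \<omega>)))"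
      by (intro sum.cong refl Bochner_Integration.integral_sum[symmetric] integrable_mult_right int) auto
    also have "\<dots> = integral\<^sup>L M (\<lambda>\<omega>. \<Sum>i<?n. \<Sum>j<?n. v $ i * v $ j * (Y i \<omega> * Y j \<omega>))"
      by (intro Bochner_Integration.integral_sum[symmetric] Bochner_Integration.integrable_sum
          integrable_mult_right int) auto
    also have "\<dots> = integral\<^sup>L M (\<lambda>\<omega>. (\<Sum>i<?n. v $ i * Y i \<omega>)\<^sup>2)"
      by (simp add: power2_eq_square sum_product algebra_simps)
    also have "\<dots> \<ge> 0" by simp
    finally show ?thesis .
  qed
  moreover have "transpose_mat (cov_mat M X X) = cov_mat M X X"
    unfolding cov by (intro eq_matI) (auto simp: mult.commute)
  ultimately show ?thesis by (simp add: pos_semidef_def cov)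
qed

lemma group_cov_inverse:
  assumes fv: "\<And>i. i \<in> G \<Longrightarrow> finite_variance M (p i)" and "finite G"
    and inv: "invertible_mat (group_cov M p G)"
  defines "D \<equiv> the (mat_inverse (group_cov M p G))"
  shows "D \<in> carrier_mat (card G) (card G)" "pos_semidef D"
    and "w \<in> carrier_vec (card G) \<Longrightarrow> w \<bullet> (D *\<^sub>v w) = 0 \<Longrightarrow> w = 0\<^sub>v (card G)"
proof -
  let ?C = "group_cov M p G"
  let ?n = "card G"
  have C: "?C \<in> carrier_mat ?n ?n" by (simp add: group_cov_def cov_mat_def group_output_def)
  have psd: "pos_semidef ?C"
    unfolding group_cov_def
    by (rule pos_semidef_cov_mat) (auto simp: group_output_def intro!: fv pick_in_set_le)
  obtain B where B: "?C * B = 1\<^sub>m ?n" "B * ?C = 1\<^sub>m (dim_row B)"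
    using inv C by (auto simp: invertible_mat_def inverts_mat_def)
  have "dim_col B = ?n" using arg_cong[OF B(1), of dim_col] by simp
  moreover have "dim_row B = ?n" using arg_cong[OF B(2), of dim_col] C by simp
  ultimately have "B \<in> carrier_mat ?n ?n" by auto
  then have "?C \<in> Units (ring_mat TYPE(real) ?n ())"
    using B C by (auto simp: Units_def ring_mat_def)
  then obtain D' where "mat_inverse ?C = Some D'"
    using mat_inverse(1)[OF C, where b = "()"] by (cases "mat_inverse ?C") auto
  then have D: "?C * D = 1\<^sub>m ?n" "D * ?C = 1\<^sub>m ?n" "D \<in> carrier_mat ?n ?n"
    using mat_inverse(2)[OF C] unfolding D_def by auto
  show "D \<in> carrier_mat (card G) (card G)" by (rule D)
  show "pos_semidef D" "w \<in> carrier_vec (card G) \<Longrightarrow> w \<bullet> (D *\<^sub>v w) = 0 \<Longrightarrow> w = 0\<^sub>v (card G)"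
    using pos_def_inverse[OF psd C D(3,1,2)] by blast+
qed

section \<open>The matrix of the sample allocation\<close>

lemma restriction_mat_carrier:
  assumes "G \<subseteq> {..<l}"
  shows "restriction_mat l G \<in> carrier_mat (card G) l"
proof -
  have "{i. i < l \<and> i \<in> G} = G" using assms by auto
  then show ?thesis by (intro carrier_matI) (auto simp: restriction_mat_def dim_submatrix)
qed

lemma restriction_mat_eq_0_imp_entry_eq_0:
  assumes G: "G \<subseteq> {..<l}" and x: "x \<in> carrier_vec l" and 0: "restriction_mat l G *\<^sub>v x = 0\<^sub>v (card G)"
    and i: "i \<in> G"
  shows "x $ i = 0"
proof -
  let ?R = "restriction_mat l G"
  let ?r = "card {a \<in> G. a < i}"
  have R: "?R \<in> carrier_mat (card G) l" using G by (rule restriction_mat_carrier)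
  have fin: "finite G" using G finite_subset by blast
  have r: "?r < card G" using i fin by (intro psubset_card_mono) auto
  have il: "i < l" using i G by auto
  have entry: "?R $$ (?r, j) = (if i = j then 1 else 0)" if "j < l" for j
  proof -
    have "{a. a < j} = {..<j}" by auto
    then have "?R $$ (?r, j) = (1\<^sub>m l :: real mat) $$ (i, j)"
      using submatrix_index_card[of i "1\<^sub>m l :: real mat" j G UNIV] that i il
      by (simp add: restriction_mat_def)
    then show ?thesis using that il by simp
  qed
  have "(?R *\<^sub>v x) $ ?r = (\<Sum>j<l. ?R $$ (?r, j) * x $ j)"
    using R r x by (simp add: scalar_prod_def lessThan_atLeast0)
  also have "\<dots> = (\<Sum>j<l. if i = j then x $ j else 0)"
    by (rule sum.cong) (auto simp: entry)
  also have "\<dots> = x $ i" using il by simp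
  finally show ?thesis using 0 r by simp
qed

lemma form_sum_mat:
  fixes B :: "nat \<Rightarrow> real mat"
  assumes B: "\<And>k. k < N \<Longrightarrow> B k \<in> carrier_mat l l" and x: "x \<in> carrier_vec l"
  shows "x \<bullet> (mat l l (\<lambda>(i, j). \<Sum>k<N. B k $$ (i, j)) *\<^sub>v x) = (\<Sum>k<N. x \<bullet> (B k *\<^sub>v x))"
proof -
  have "x \<bullet> (mat l l (\<lambda>(i, j). \<Sum>k<N. B k $$ (i, j)) *\<^sub>v x)
    = (\<Sum>i<l. \<Sum>j<l. \<Sum>k<N. x $ i * (B k $$ (i, j) * x $ j))"
    using x by (simp add: scalar_prod_def lessThan_atLeast0 sum_distrib_left sum_distrib_right)
  also have "\<dots> = (\<Sum>i<l. \<Sum>k<N. \<Sum>j<l. x $ i * (B k $$ (i, j) * x $ j))"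
    by (intro sum.cong refl sum.swap)
  also have "\<dots> = (\<Sum>k<N. \<Sum>i<l. \<Sum>j<l. x $ i * (B k $$ (i, j) * x $ j))"
    by (rule sum.swap)
  also have "\<dots> = (\<Sum>k<N. x \<bullet> (B k *\<^sub>v x))"
  proof (rule sum.cong)
    fix k assume "k \<in> {..<N}"
    then have "B k \<in> carrier_mat l l" using B by simp
    then show "(\<Sum>i<l. \<Sum>j<l. x $ i * (B k $$ (i, j) * x $ j)) = x \<bullet> (B k *\<^sub>v x)"
      using x by (auto simp: scalar_prod_def lessThan_atLeast0 sum_distrib_left)
  qed simp
  finally show ?thesis .
qed

lemma transpose_smult_mat: "transpose_mat (c \<cdot>\<^sub>m A) = c \<cdot>\<^sub>m transpose_mat A"
  by (intro eq_matI) auto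

lemma weighted_congruence:
  fixes D :: "real mat"
  assumes D: "D \<in> carrier_mat m m" "transpose_mat D = D" and R: "R \<in> carrier_mat m l"
  shows "c \<cdot>\<^sub>m (transpose_mat R * D * R) \<in> carrier_mat l l"
    and "transpose_mat (c \<cdot>\<^sub>m (transpose_mat R * D * R)) = c \<cdot>\<^sub>m (transpose_mat R * D * R)"
    and "x \<in> carrier_vec l \<Longrightarrow>
      x \<bullet> (c \<cdot>\<^sub>m (transpose_mat R * D * R) *\<^sub>v x) = c * ((R *\<^sub>v x) \<bullet> (D *\<^sub>v (R *\<^sub>v x)))"
proof -
  let ?S = "transpose_mat R * D * R"
  have S: "?S \<in> carrier_mat l l" using D R by simp
  show "c \<cdot>\<^sub>m ?S \<in> carrier_mat l l" using S by simp
  have "transpose_mat ?S = ?S" using D R by (simp add: transpose_mult_dim mult_assoc_mat_dim)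
  then show "transpose_mat (c \<cdot>\<^sub>m ?S) = c \<cdot>\<^sub>m ?S"
    by (metis transpose_smult_mat)
  assume x: "x \<in> carrier_vec l"
  have "c \<cdot>\<^sub>m ?S *\<^sub>v x = c \<cdot>\<^sub>v (?S *\<^sub>v x)"
    using S x by (intro eq_vecI) auto
  then have "x \<bullet> (c \<cdot>\<^sub>m ?S *\<^sub>v x) = c * (x \<bullet> (?S *\<^sub>v x))" using S x by simp
  also have "?S *\<^sub>v x = transpose_mat R *\<^sub>v (D *\<^sub>v (R *\<^sub>v x))"
    using D R x by (simp add: assoc_mult_mat_vec[of _ l m _ l] assoc_mult_mat_vec[of _ l m _ m])
  also have "x \<bullet> \<dots> = \<dots> \<bullet> x" using D R x by (intro comm_scalar_prod[of _ l]) auto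
  also have "\<dots> = (D *\<^sub>v (R *\<^sub>v x)) \<bullet> (R *\<^sub>v x)"
    using D R x by (intro transpose_vec_mult_scalar[of _ m l]) auto
  also have "\<dots> = (R *\<^sub>v x) \<bullet> (D *\<^sub>v (R *\<^sub>v x))"
    using D R x by (intro comm_scalar_prod[of _ m]) auto
  finally show "x \<bullet> (c \<cdot>\<^sub>m ?S *\<^sub>v x) = c * ((R *\<^sub>v x) \<bullet> (D *\<^sub>v (R *\<^sub>v x)))" .
qed

text \<open>
  The form of \<open>\<Psi>\<close> is a sum of nonnegative terms, one for each group.  At a kernel vector \<open>x\<close> all of them
  vanish, and by positive definiteness of the inverse covariances \<open>x\<close> vanishes on every group that is
  sampled at all.
\<close>

lemma Psi_pos_semidef_and_kernel:
  assumes fv: "\<And>i. i < l \<Longrightarrow> finite_variance M (p i)"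
    and Gs: "\<And>G. G \<in> set Gs \<Longrightarrow> G \<subseteq> {..<l}"
    and inv: "\<And>G. G \<in> set Gs \<Longrightarrow> invertible_mat (group_cov M p G)"
    and n: "\<And>k. k < length Gs \<Longrightarrow> 0 \<le> n $ k"
  shows "pos_semidef (Psi M p l Gs n)"
    and "x \<in> carrier_vec l \<Longrightarrow> Psi M p l Gs n *\<^sub>v x = 0\<^sub>v l \<Longrightarrow> k < length Gs \<Longrightarrow> 0 < n $ k \<Longrightarrow> i \<in> Gs ! k
      \<Longrightarrow> x $ i = 0"
proof -
  define R where "R k = restriction_mat l (Gs ! k)" for k
  define D where "D k = the (mat_inverse (group_cov M p (Gs ! k)))" for k
  define m where "m k = card (Gs ! k)" for k
  define B where "B k = n $ k \<cdot>\<^sub>m (transpose_mat (R k) * D k * R k)" for k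
  have Psi: "Psi M p l Gs n = mat l l (\<lambda>(i, j). \<Sum>k<length Gs. B k $$ (i, j))"
    unfolding Psi_def B_def R_def D_def ..
  have R: "R k \<in> carrier_mat (m k) l" if "k < length Gs" for k
    unfolding R_def m_def using that Gs by (intro restriction_mat_carrier) auto
  have D: "D k \<in> carrier_mat (m k) (m k)" "pos_semidef (D k)"
    "w \<in> carrier_vec (m k) \<Longrightarrow> w \<bullet> (D k *\<^sub>v w) = 0 \<Longrightarrow> w = 0\<^sub>v (m k)" if "k < length Gs" for k w
  proof -
    have G: "Gs ! k \<in> set Gs" using that by simp
    then have sub: "Gs ! k \<subseteq> {..<l}" by (rule Gs)
    then have "finite (Gs ! k)" using finite_subset by blast
    note * = group_cov_inverse[of "Gs ! k" M p, OF _ this inv[OF G]]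
    show "D k \<in> carrier_mat (m k) (m k)" "pos_semidef (D k)"
      "w \<in> carrier_vec (m k) \<Longrightarrow> w \<bullet> (D k *\<^sub>v w) = 0 \<Longrightarrow> w = 0\<^sub>v (m k)"
      unfolding D_def m_def using * fv sub by blast+
  qed
  have symD: "transpose_mat (D k) = D k" if "k < length Gs" for k
    using D(2)[OF that] by (simp add: pos_semidef_def)
  have B: "B k \<in> carrier_mat l l" "transpose_mat (B k) = B k" if "k < length Gs" for k
    unfolding B_def using weighted_congruence(1,2)[OF D(1) symD R] that by blast+
  have form: "x \<bullet> (Psi M p l Gs n *\<^sub>v x)
      = (\<Sum>k<length Gs. n $ k * ((R k *\<^sub>v x) \<bullet> (D k *\<^sub>v (R k *\<^sub>v x))))" if "x \<in> carrier_vec l" for x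
  proof -
    have "x \<bullet> (Psi M p l Gs n *\<^sub>v x) = (\<Sum>k<length Gs. x \<bullet> (B k *\<^sub>v x))"
      unfolding Psi by (rule form_sum_mat[OF B(1) that])
    also have "\<dots> = (\<Sum>k<length Gs. n $ k * ((R k *\<^sub>v x) \<bullet> (D k *\<^sub>v (R k *\<^sub>v x))))"
      unfolding B_def by (intro sum.cong refl weighted_congruence(3)[OF D(1) symD R that]) auto
    finally show ?thesis .
  qed
  have terms: "0 \<le> n $ k * ((R k *\<^sub>v x) \<bullet> (D k *\<^sub>v (R k *\<^sub>v x)))"
    if "k < length Gs" "x \<in> carrier_vec l" for k x
  proof -
    have "R k *\<^sub>v x \<in> carrier_vec (m k)" using R[OF that(1)] that(2) by simp
    then have "0 \<le> (R k *\<^sub>v x) \<bullet> (D k *\<^sub>v (R k *\<^sub>v x))"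
      using D(1,2)[OF that(1)] by (auto simp: pos_semidef_def)
    then show ?thesis using n[OF that(1)] by simp
  qed
  have "B k $$ (j, i) = B k $$ (i, j)" if "k < length Gs" "i < l" "j < l" for k i j
    using arg_cong[OF B(2)[OF that(1)], of "\<lambda>A. A $$ (i, j)"] B(1)[OF that(1)] that by simp
  then have sym: "transpose_mat (Psi M p l Gs n) = Psi M p l Gs n"
    unfolding Psi by (intro eq_matI) (auto intro!: sum.cong)
  have dims: "dim_row (Psi M p l Gs n) = l" "dim_col (Psi M p l Gs n) = l" by (simp_all add: Psi)
  show "pos_semidef (Psi M p l Gs n)"
    using sym terms by (auto simp: pos_semidef_def dims form intro!: sum_nonneg)
  assume x: "x \<in> carrier_vec l" "Psi M p l Gs n *\<^sub>v x = 0\<^sub>v l"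
    and k: "k < length Gs" "0 < n $ k" "i \<in> Gs ! k"
  have "(\<Sum>k<length Gs. n $ k * ((R k *\<^sub>v x) \<bullet> (D k *\<^sub>v (R k *\<^sub>v x)))) = 0"
    using form[OF x(1)] x by simp
  then have "\<forall>k\<in>{..<length Gs}. n $ k * ((R k *\<^sub>v x) \<bullet> (D k *\<^sub>v (R k *\<^sub>v x))) = 0"
    using terms[OF _ x(1)] by (subst (asm) sum_nonneg_eq_0_iff) auto
  then have "n $ k * ((R k *\<^sub>v x) \<bullet> (D k *\<^sub>v (R k *\<^sub>v x))) = 0" using k(1) by simp
  then have "R k *\<^sub>v x = 0\<^sub>v (m k)" using k R[OF k(1)] x(1) by (intro D(3)) auto
  then show "x $ i = 0"
    unfolding R_def m_def using k Gs x(1) by (intro restriction_mat_eq_0_imp_entry_eq_0[of "Gs ! k" l]) auto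
qed

section \<open>Equivalence of the two problems\<close>

lemma hf_group_sampled:
  assumes "n \<in> carrier_vec (length Gs)" "0\<^sub>v (length Gs) \<le> n" "n \<bullet> hf_indicator Gs \<ge> 1"
  shows "\<exists>k<length Gs. 0 < n $ k \<and> 0 \<in> Gs ! k"
proof (rule ccontr)
  assume *: "\<not> ?thesis"
  have "n $ k * hf_indicator Gs $ k = 0" if "k < length Gs" for k
  proof (cases "0 \<in> Gs ! k")
    case True
    then have "\<not> 0 < n $ k" using * that by blast
    moreover have "0 \<le> n $ k" using assms(1,2) that by (auto simp: less_eq_vec_def)
    ultimately show ?thesis by simp
  qed (simp add: hf_indicator_def that)
  moreover have "dim_vec (hf_indicator Gs) = length Gs" by (simp add: hf_indicator_def)
  ultimately have "n \<bullet> hf_indicator Gs = 0"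
    unfolding scalar_prod_def by (intro sum.neutral) auto
  then show False using assms(3) by simp
qed

theorem corollary3p4:
  fixes M :: "'a measure"
    and p :: "nat \<Rightarrow> 'a \<Rightarrow> real"
    and l :: nat
    and Gs :: "nat set list"
    and c :: "real vec"
    and eps :: real
  assumes "prob_space M"
    and "l \<ge> 1"
    and "\<And>i. i < l \<Longrightarrow> finite_variance M (p i)"
    and "distinct Gs"
    and "\<And>G. G \<in> set Gs \<Longrightarrow> G \<noteq> {} \<and> G \<subseteq> {..<l}"
    and "c \<in> carrier_vec (length Gs)"
    and "eps\<^sup>2 > 0"
    and "\<And>G. G \<in> set Gs \<Longrightarrow> invertible_mat (group_cov M p G)"
  shows "feasible_pinv M p l Gs eps = feasible_sdp M p l Gs eps
    \<and> optimal_value (\<lambda>n. n \<bullet> c) (feasible_pinv M p l Gs eps)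
       = optimal_value (\<lambda>n. n \<bullet> c) (feasible_sdp M p l Gs eps)
    \<and> optimal_solutions (\<lambda>n. n \<bullet> c) (feasible_pinv M p l Gs eps)
       = optimal_solutions (\<lambda>n. n \<bullet> c) (feasible_sdp M p l Gs eps)"
proof -
  have "unit_vec l 0 \<bullet> (pseudo_inverse (Psi M p l Gs n) *\<^sub>v unit_vec l 0) \<le> eps\<^sup>2
      \<longleftrightarrow> pos_semidef (Phi M p l Gs (eps\<^sup>2) n)"
    if n: "n \<in> carrier_vec (length Gs)" "0\<^sub>v (length Gs) \<le> n" "n \<bullet> hf_indicator Gs \<ge> 1" for n
  proof -
    have nonneg: "0 \<le> n $ k" if "k < length Gs" for k
      using n(2) that by (auto simp: less_eq_vec_def)
    have sub: "G \<subseteq> {..<l}" if "G \<in> set Gs" for G using assms(5)[OF that] by simp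
    note Psi = Psi_pos_semidef_and_kernel[of l M p Gs n, OF assms(3) sub assms(8) nonneg]
    obtain k where k: "k < length Gs" "0 < n $ k" "0 \<in> Gs ! k"
      using hf_group_sampled[OF n] by blast
    have "Psi M p l Gs n \<in> carrier_mat l l" by (simp add: Psi_def)
    moreover have "x \<bullet> unit_vec l 0 = 0"
      if "x \<in> carrier_vec l" "Psi M p l Gs n *\<^sub>v x = 0\<^sub>v l" for x
      using Psi(2)[OF _ _ _ _ that k] assms(2) that(1) by simp
    ultimately show ?thesis
      unfolding Phi_def by (intro pos_semidef_bordered_iff[symmetric] Psi(1)) auto
  qed
  then have "feasible_pinv M p l Gs eps = feasible_sdp M p l Gs eps"
    unfolding feasible_pinv_def feasible_sdp_def by blast
  then show ?thesis by simp
qed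

end
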